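(* Let $r\ge 2$, let $\alpha_1,\dots,\alpha_r,\beta_1,\dots,\beta_r,\gamma>-1$ be real numbers with $(\alpha_i,\beta_i)\neq(\alpha_j,\beta_j)$ for $i\ne j$, and let $0\le k_j\le n_j$ ($j=1,\dots,r$) be integers. Then the polynomial $$U^{(\vec\alpha,\vec\beta,\gamma)}_{\vec n,\vec k}(x,y)=D_r\circ\cdots\circ D_1\big[(1-x-y)^{n_1+\cdots+n_r}\big]$$ satisfies, for every $j\in\{1,\dots,r\}$ and all integers $0\le k\le n$, $$\int_T U^{(\vec\alpha,\vec\beta,\gamma)}_{\vec n,\vec k}(x,y)\,x^{n-k}y^{k}\,W_j(x,y)\,dx\,dy=0\qquad\text{whenever } 0\le n-k<n_j-k_j\ \text{ or }\ 0\le k<k_j .$$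
   Context: Let $T=\{(x,y)\in\mathbb R^2: x\ge 0,\ y\ge 0,\ x+y\le 1\}$ and $W_j(x,y)=x^{\alpha_j}y^{\beta_j}(1-x-y)^{\gamma}$ for $j=1,\dots,r$. For integers $0\le k_j\le n_j$ and a smooth function $f$, the operator $D_j$ is $$D_j[f(x,y)]=\frac{1}{W_j(x,y)}\,\frac{\partial^{n_j}}{\partial x^{n_j-k_j}\,\partial y^{k_j}}\Big(W_j(x,y)\,x^{n_j-k_j}y^{k_j}f(x,y)\Big),$$ all expressions being taken on the interior of $T$ (where $W_j$ is smooth and positive). The function $U^{(\vec\alpha,\vec\beta,\gamma)}_{\vec n,\vec k}$ coincides on the interior of $T$ with a polynomial of degree $n_1+\cdots+n_r$. Notation: $\vec n=(n_1,\dots,n_r)$, $\vec k=(k_1,\dots,k_r)$, $\vec\alpha=(\alpha_1,\dots,\alpha_r)$, $\vec\beta=(\beta_1,\dots,\beta_r)$. *)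

theory Defs
  imports "HOL-Analysis.Analysis"
begin

definition triangle :: "(real \<times> real) set" where
  "triangle = {(x, y). 0 \<le> x \<and> 0 \<le> y \<and> x + y \<le> 1}"

text \<open>
  Since \<open>0 powr a = 0\<close> for every real \<open>a\<close>, the weight below vanishes on the boundary of the
  triangle even where the mathematical weight does not or is infinite. The boundary is a null set,
  so this does not affect integrals.
\<close>

definition weight :: "real \<Rightarrow> real \<Rightarrow> real \<Rightarrow> real \<times> real \<Rightarrow> real" where
  "weight a b c = (\<lambda>(x, y). x powr a * y powr b * (1 - x - y) powr c)"

definition partial_x :: "(real \<times> real \<Rightarrow> real) \<Rightarrow> real \<times> real \<Rightarrow> real" where
  "partial_x f = (\<lambda>(x, y). deriv (\<lambda>t. f (t, y)) x)"

definition partial_y :: "(real \<times> real \<Rightarrow> real) \<Rightarrow> real \<times> real \<Rightarrow> real" where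
  "partial_y f = (\<lambda>(x, y). deriv (\<lambda>t. f (x, t)) y)"

text \<open>
  The operator below is meaningful at interior points of the triangle. There its value depends only
  on the germ of \<open>f\<close>, so compositions of such operators are determined on the interior by
  the values of \<open>f\<close> on the interior. It is meant for \<open>k \<le> n\<close>, so that
  \<open>n - k\<close> is not truncated.
\<close>

definition rodrigues_op ::
  "real \<Rightarrow> real \<Rightarrow> real \<Rightarrow> nat \<Rightarrow> nat \<Rightarrow> (real \<times> real \<Rightarrow> real) \<Rightarrow> real \<times> real \<Rightarrow> real" where
  "rodrigues_op a b c n k f = (\<lambda>(x, y).
     1 / weight a b c (x, y) *
     (partial_x ^^ (n - k)) ((partial_y ^^ k)
       (\<lambda>(u, v). weight a b c (u, v) * u ^ (n - k) * v ^ k * f (u, v))) (x, y))"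

text \<open>
  \<open>fold\<close> applies the operator with index \<open>1\<close> first and the one with index \<open>r\<close> last. The parameter
  vectors are functions on \<open>nat\<close> of which only the values at \<open>1, \<dots>, r\<close> are used.
  On the interior of the triangle the result is the intended polynomial; its values on the boundary
  and outside carry no meaning.
\<close>

definition mult_orth_poly ::
  "nat \<Rightarrow> (nat \<Rightarrow> real) \<Rightarrow> (nat \<Rightarrow> real) \<Rightarrow> real \<Rightarrow> (nat \<Rightarrow> nat) \<Rightarrow> (nat \<Rightarrow> nat) \<Rightarrow> real \<times> real \<Rightarrow> real" where
  "mult_orth_poly r \<alpha> \<beta> \<gamma> n k =
     fold (\<lambda>j. rodrigues_op (\<alpha> j) (\<beta> j) \<gamma> (n j) (k j)) [1..<Suc r]
       (\<lambda>(x, y). (1 - x - y) ^ (\<Sum>j=1..r. n j))"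

end

theory Submission
  imports Defs
begin

text \<open>
  Put \<open>\<theta>\<^sub>x = x \<partial>\<^sub>x\<close> and \<open>\<theta>\<^sub>y = y \<partial>\<^sub>y\<close>. Since \<open>x\<^bsup>-a\<^esup> \<partial>\<^sub>x\<^bsup>m\<^esup> x\<^bsup>a+m\<^esup>\<close> is the product of the operators
  \<open>\<theta>\<^sub>x + a + i\<close> for \<open>i = 1, \<dots>, m\<close>, every \<open>D\<^sub>j\<close> is conjugate by \<open>(1 - x - y)\<^bsup>\<gamma>\<^esup>\<close> to a product of
  commuting factors \<open>\<theta>\<^sub>x + \<alpha>\<^sub>j + i\<close> and \<open>\<theta>\<^sub>y + \<beta>\<^sub>j + i\<close>. Against \<open>x\<^bsup>p\<^esup> y\<^bsup>q\<^esup>\<close> the factor \<open>\<theta>\<^sub>x + c\<close>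
  multiplies the integral by \<open>c - p - 1\<close>, and for \<open>p = \<alpha>\<^sub>j + n - k\<close>, \<open>q = \<beta>\<^sub>j + k\<close> one of these numbers is \<open>0\<close>.
\<close>

section \<open>The open simplex and Beta integrals\<close>

text \<open>The interior of \<open>triangle\<close>: the weights are smooth and positive on it, and
  the operators are evaluated only there.\<close>

definition open_simplex :: "(real \<times> real) set" where
  "open_simplex = {(x, y). 0 < x \<and> 0 < y \<and> x + y < 1}"

lemma open_simplex_iff [simp]: "(x, y) \<in> open_simplex \<longleftrightarrow> 0 < x \<and> 0 < y \<and> x + y < 1"
  by (simp add: open_simplex_def)

lemma open_open_simplex: "open open_simplex"
proof -
  have "open ({z :: real \<times> real. 0 < fst z} \<inter> {z. 0 < snd z} \<inter> {z. fst z + snd z < 1})"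
    by (intro open_Int open_Collect_less continuous_intros)
  also have "{z :: real \<times> real. 0 < fst z} \<inter> {z. 0 < snd z} \<inter> {z. fst z + snd z < 1} = open_simplex"
    by (auto simp: open_simplex_def)
  finally show ?thesis .
qed

lemma open_simplex_borel [measurable]: "open_simplex \<in> sets (borel \<Otimes>\<^sub>M borel)"
  by (subst borel_prod) (rule borel_open[OF open_open_simplex])

lemma nn_integral_Beta:
  fixes p q :: real
  assumes "-1 < p" "-1 < q"
  shows "(\<integral>\<^sup>+t. ennreal (t powr p * (1 - t) powr q) * indicator {0<..<1} t \<partial>lborel)
    = ennreal (Beta (p + 1) (q + 1))"
proof -
  have "((\<lambda>t. t powr p * (1 - t) powr q) has_integral Beta (p + 1) (q + 1)) {0<..<1}"
    using has_integral_Beta_real[of "p + 1" "q + 1"] assms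
    by (simp add: has_integral_Icc_iff_Ioo)
  then show ?thesis
    by (intro nn_integral_has_integral_lebesgue') auto
qed

text \<open>Substituting \<open>c * t\<close> for \<open>t\<close> yields
  \<open>c powr (p + q)\<close> from the integrand and one more factor \<open>c\<close> from the
  measure. With \<open>c = 1 - x\<close> this is the integral over the slice of the simplex at fixed
  \<open>x\<close>.\<close>

lemma nn_integral_Beta_scaled:
  fixes p q c :: real
  assumes "-1 < p" "-1 < q" "0 < c"
  shows "(\<integral>\<^sup>+t. ennreal (t powr p * (c - t) powr q) * indicator {0<..<c} t \<partial>lborel)
    = ennreal (c powr (p + q + 1) * Beta (p + 1) (q + 1))"
proof -
  have "(\<integral>\<^sup>+t. ennreal (t powr p * (c - t) powr q) * indicator {0<..<c} t \<partial>lborel)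
    = \<bar>c\<bar> * (\<integral>\<^sup>+t. ennreal ((0 + c * t) powr p * (c - (0 + c * t)) powr q)
        * indicator {0<..<c} (0 + c * t) \<partial>lborel)"
    using assms by (intro nn_integral_real_affine) auto
  also have "(\<integral>\<^sup>+t. ennreal ((0 + c * t) powr p * (c - (0 + c * t)) powr q)
        * indicator {0<..<c} (0 + c * t) \<partial>lborel)
    = (\<integral>\<^sup>+t. ennreal (c powr (p + q)) * (ennreal (t powr p * (1 - t) powr q)
        * indicator {0<..<1} t) \<partial>lborel)"
  proof (rule nn_integral_cong)
    fix t :: real
    show "ennreal ((0 + c * t) powr p * (c - (0 + c * t)) powr q) * indicator {0<..<c} (0 + c * t)
      = ennreal (c powr (p + q)) * (ennreal (t powr p * (1 - t) powr q) * indicator {0<..<1} t)"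
    proof (cases "t \<in> {0<..<1}")
      case True
      have "c - c * t = c * (1 - t)" by (simp add: algebra_simps)
      then show ?thesis using True assms
        by (simp add: powr_mult powr_add ennreal_mult' mult_ac)
    next
      case False
      then have "0 + c * t \<notin> {0<..<c}" using assms(3) by (auto simp: zero_less_mult_iff)
      then show ?thesis using False by simp
    qed
  qed
  also have "\<dots> = ennreal (c powr (p + q)) * ennreal (Beta (p + 1) (q + 1))"
    using nn_integral_Beta[OF assms(1,2)] by (subst nn_integral_cmult) auto
  also have "\<bar>c\<bar> * \<dots> = ennreal (c powr (p + q + 1) * Beta (p + 1) (q + 1))"
    using assms by (simp add: powr_add ennreal_mult' mult_ac)
  finally show ?thesis .
qed

section \<open>Moments of functions on the open simplex\<close>

text \<open>Integrability and value are carried together. The exponents are real so that they can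
  absorb the factors \<open>x powr \<alpha> j\<close> and \<open>y powr \<beta> j\<close> of a
  weight, while \<open>F\<close> carries the power of \<open>1 - x - y\<close>.\<close>

definition has_moment :: "real \<Rightarrow> real \<Rightarrow> (real \<times> real \<Rightarrow> real) \<Rightarrow> real \<Rightarrow> bool" where
  "has_moment p q F I \<longleftrightarrow> has_bochner_integral lborel
     (\<lambda>(x, y). indicator open_simplex (x, y) * (x powr p * y powr q * F (x, y))) I"

text \<open>The Dirichlet integral. By Tonelli the slice integrals leave a second Beta integral in
  \<open>x\<close>, and \<open>Gamma (q + s + 2)\<close> cancels between the two Beta values. Since
  the integrand is nonnegative, finiteness of the result also gives integrability.\<close>

lemma has_moment_dirichlet:
  assumes "-1 < p" "-1 < q" "-1 < s"
  shows "has_moment p q (\<lambda>(x, y). (1 - x - y) powr s)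
    (Gamma (p + 1) * Gamma (q + 1) * Gamma (s + 1) / Gamma (p + q + s + 3))"
proof -
  define f :: "real \<times> real \<Rightarrow> real" where "f = (\<lambda>(x, y). indicator open_simplex (x, y)
     * (x powr p * y powr q * (1 - x - y) powr s))"
  have "f \<in> borel_measurable (borel \<Otimes>\<^sub>M borel)"
    unfolding f_def by measurable
  then have f_meas [measurable]: "f \<in> borel_measurable borel" by (simp add: borel_prod)
  have f_nonneg: "0 \<le> f z" for z
    by (cases z) (simp add: f_def)
  have G: "Gamma (p + q + s + 3) > 0" "Gamma (q + s + 2) > 0" "Gamma (p + 1) > 0"
    "Gamma (q + 1) > 0" "Gamma (s + 1) > 0"
    using assms by (auto intro!: Gamma_real_pos)
  have "(\<integral>\<^sup>+z. ennreal (f z) \<partial>lborel) = (\<integral>\<^sup>+x. \<integral>\<^sup>+y. ennreal (f (x, y)) \<partial>lborel \<partial>lborel)"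
    by (subst lborel_prod[symmetric], subst lborel.nn_integral_fst[symmetric])
       (simp_all add: lborel_prod)
  also have "\<dots> = (\<integral>\<^sup>+x. ennreal (Beta (q + 1) (s + 1)) *
      (ennreal (x powr p * (1 - x) powr (q + s + 1)) * indicator {0<..<1} x) \<partial>lborel)"
  proof (rule nn_integral_cong)
    fix x :: real
    show "(\<integral>\<^sup>+y. ennreal (f (x, y)) \<partial>lborel) = ennreal (Beta (q + 1) (s + 1)) *
      (ennreal (x powr p * (1 - x) powr (q + s + 1)) * indicator {0<..<1} x)"
    proof (cases "x \<in> {0<..<1}")
      case True
      have "(\<integral>\<^sup>+y. ennreal (f (x, y)) \<partial>lborel) = (\<integral>\<^sup>+y. ennreal (x powr p) *
        (ennreal (y powr q * (1 - x - y) powr s) * indicator {0<..<1 - x} y) \<partial>lborel)"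
        using True by (intro nn_integral_cong)
          (auto simp: f_def indicator_def ennreal_mult'[symmetric] mult_ac)
      also have "\<dots> = ennreal (x powr p) *
          ennreal ((1 - x) powr (q + s + 1) * Beta (q + 1) (s + 1))"
        using nn_integral_Beta_scaled[of q s "1 - x"] True assms
        by (subst nn_integral_cmult) auto
      finally show ?thesis
        using True by (simp add: ennreal_mult'[symmetric] ennreal_mult''[symmetric] mult_ac)
    next
      case False
      then have "f (x, y) = 0" for y by (auto simp: f_def indicator_def)
      then show ?thesis using False by simp
    qed
  qed
  also have "\<dots> = ennreal (Beta (q + 1) (s + 1)) * ennreal (Beta (p + 1) (q + s + 2))"
    using nn_integral_Beta[of p "q + s + 1"] assms
    by (subst nn_integral_cmult) (auto simp: add_ac)
  also have "\<dots> = ennreal (Beta (q + 1) (s + 1) * Beta (p + 1) (q + s + 2))"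
    using G by (subst ennreal_mult'[symmetric]) (auto simp: Beta_def add_ac)
  also have "Beta (q + 1) (s + 1) * Beta (p + 1) (q + s + 2)
    = Gamma (p + 1) * Gamma (q + 1) * Gamma (s + 1) / Gamma (p + q + s + 3)"
    using G by (simp add: Beta_def field_simps add_ac)
  finally have "has_bochner_integral lborel f
      (Gamma (p + 1) * Gamma (q + 1) * Gamma (s + 1) / Gamma (p + q + s + 3))"
    using G f_nonneg by (intro has_bochner_integral_nn_integral) auto
  then show ?thesis by (simp add: has_moment_def f_def)
qed

lemma has_moment_unique: "has_moment p q F I \<Longrightarrow> has_moment p q F J \<Longrightarrow> I = J"
  unfolding has_moment_def by (rule has_bochner_integral_eq)

lemma has_moment_add:
  assumes "has_moment p q F I" "has_moment p q G J"
  shows "has_moment p q (\<lambda>z. F z + G z) (I + J)"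
  using has_bochner_integral_add[OF assms[unfolded has_moment_def]]
  by (simp add: has_moment_def case_prod_unfold algebra_simps)

lemma has_moment_cmult:
  assumes "has_moment p q F I"
  shows "has_moment p q (\<lambda>z. c * F z) (c * I)"
  using has_bochner_integral_mult_right[OF assms[unfolded has_moment_def], of c]
  by (simp add: has_moment_def case_prod_unfold mult_ac)

text \<open>Only the products with the monomials have to agree, so powers of \<open>x\<close> and
  \<open>y\<close> may move between the exponents and the function.\<close>

lemma has_moment_cong:
  assumes "has_moment p q F I" "\<And>x y. (x, y) \<in> open_simplex \<Longrightarrow>
    x powr p * y powr q * F (x, y) = x powr p' * y powr q' * G (x, y)"
  shows "has_moment p' q' G I"
proof -
  have "(\<lambda>(x, y). indicator open_simplex (x, y) * (x powr p * y powr q * F (x, y)))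
     = (\<lambda>(x, y). indicator open_simplex (x, y) * (x powr p' * y powr q' * G (x, y)))"
    using assms(2) by (fastforce simp: indicator_def)
  then show ?thesis using assms(1) by (simp add: has_moment_def)
qed

text \<open>The simplex and Lebesgue measure are symmetric in the coordinates; this reduces the
  statements on \<open>y\<close> to those on \<open>x\<close>.\<close>

lemma has_moment_swap:
  assumes "has_moment p q F I"
  shows "has_moment q p (\<lambda>(x, y). F (y, x)) I"
proof -
  define f where "f = (\<lambda>(x, y). indicator open_simplex (x, y) * (x powr p * y powr q * F (x, y)))"
  have f: "integrable (lborel \<Otimes>\<^sub>M lborel) f" "integral\<^sup>L (lborel \<Otimes>\<^sub>M lborel) f = I"
    using assms by (simp_all add: has_moment_def f_def has_bochner_integral_iff lborel_prod)
  have "has_bochner_integral (lborel \<Otimes>\<^sub>M lborel) (\<lambda>(x, y). f (y, x)) I"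
    using lborel_pair.integrable_product_swap[OF f(1)]
      lborel_pair.integral_product_swap[OF borel_measurable_integrable[OF f(1)]] f(2)
    by (simp add: has_bochner_integral_iff)
  moreover have "(\<lambda>(x, y). f (y, x)) =
    (\<lambda>(x, y). indicator open_simplex (x, y) * (x powr q * y powr p * F (y, x)))"
    by (auto simp: f_def indicator_def fun_eq_iff)
  ultimately show ?thesis by (simp add: has_moment_def lborel_prod)
qed

text \<open>Functions on the simplex that are homogeneous of degree \<open>t\<close> in the barycentric coordinates
  \<open>(x, y, 1 - x - y)\<close>.\<close>

inductive hom_span :: "real \<Rightarrow> nat \<Rightarrow> (real \<times> real \<Rightarrow> real) \<Rightarrow> bool" for t m where
  monom: "a + b \<le> m \<Longrightarrow> hom_span t m
    (\<lambda>(x, y). c * (x ^ a * y ^ b * (1 - x - y) powr (t - real a - real b)))"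
| add: "hom_span t m F \<Longrightarrow> hom_span t m G \<Longrightarrow> hom_span t m (\<lambda>z. F z + G z)"

lemma hom_span_swap:
  assumes "hom_span t m F"
  shows "hom_span t m (\<lambda>(x, y). F (y, x))"
  using assms
proof induction
  case (monom a b c)
  have "(\<lambda>(x, y). case (y, x) of (x, y) \<Rightarrow> c * (x ^ a * y ^ b * (1 - x - y) powr (t - real a - real b)))
    = (\<lambda>(x, y). c * (x ^ b * y ^ a * (1 - x - y) powr (t - real b - real a)))"
    by (auto simp: algebra_simps)
  then show ?case using hom_span.monom[of b a m t c] monom by (simp add: add.commute)
next
  case (add F G)
  then show ?case using hom_span.add[OF add.IH] by (simp add: case_prod_beta)
qed

lemma has_moment_term:
  assumes "-1 < p" "-1 < q" "-1 < s"
  shows "has_moment p q (\<lambda>(x, y). c * (x ^ a * y ^ b * (1 - x - y) powr s))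
    (c * (Gamma (p + a + 1) * Gamma (q + b + 1) * Gamma (s + 1) / Gamma (p + a + q + b + s + 3)))"
proof -
  have "has_moment p q (\<lambda>(x, y). x ^ a * y ^ b * (1 - x - y) powr s)
    (Gamma (p + a + 1) * Gamma (q + b + 1) * Gamma (s + 1) / Gamma (p + a + q + b + s + 3))"
  proof (rule has_moment_cong)
    show "has_moment (p + a) (q + b) (\<lambda>(x, y). (1 - x - y) powr s)
      (Gamma (p + a + 1) * Gamma (q + b + 1) * Gamma (s + 1) / Gamma (p + a + q + b + s + 3))"
      using has_moment_dirichlet[of "p + a" "q + b" s] assms by (simp add: add.assoc)
  qed (simp add: powr_add powr_realpow mult_ac)
  from has_moment_cmult[OF this, of c] show ?thesis by (simp add: case_prod_unfold)
qed

text \<open>In each term \<open>1 - x - y\<close> has exponent at least \<open>t - m > -1\<close>,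
  so its Dirichlet integral converges.\<close>

lemma hom_span_has_moment:
  assumes "hom_span t m F" "-1 < p" "-1 < q" "real m - 1 < t"
  shows "\<exists>I. has_moment p q F I"
  using assms(1)
proof induction
  case (monom a b c)
  then have "-1 < t - real a - real b" using assms(4) by linarith
  from has_moment_term[OF assms(2,3) this] show ?case by blast
qed (blast intro: has_moment_add)

text \<open>\<open>G\<close> is the image of \<open>F\<close> under \<open>x \<partial>\<^sub>x + c\<close>, whose formal adjoint multiplies the monomial
  \<open>x\<^sup>p y\<^sup>q\<close> by \<open>c - p - 1\<close>. The Dirichlet integrals give this without integrating by parts.\<close>

lemma hom_span_euler:
  assumes "hom_span t m F" "real m < t"
  shows "\<exists>G. hom_span t (Suc m) G \<and>
    (\<forall>x y. (x, y) \<in> open_simplex \<longrightarrow>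
      ((\<lambda>u. F (u, y)) has_real_derivative (G (x, y) - c * F (x, y)) / x) (at x)) \<and>
    (\<forall>p q. -1 < p \<longrightarrow> -1 < q \<longrightarrow> (\<exists>I. has_moment p q F I \<and> has_moment p q G ((c - p - 1) * I)))"
  using assms(1)
proof induction
  case (monom a b d)
  define s where "s = t - real a - real b"
  \<comment> \<open>Here \<open>a + b \<le> m < t\<close>. Differentiation lowers the exponent to
    \<open>s - 1\<close>, which is still above \<open>-1\<close>, so moments continue to
    exist.\<close>
  have s: "s > 0" "t - real (Suc a) - real b = s - 1"
    using assms(2) monom by (auto simp: s_def)
  define F where "F = (\<lambda>(x, y). d * (x ^ a * y ^ b * (1 - x - y :: real) powr s))"
  \<comment> \<open>The two parts of the image of \<open>F\<close>: differentiating
    \<open>x ^ a\<close> and adding \<open>c\<close> gives \<open>G1\<close>; differentiating the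
    power of \<open>1 - x - y\<close> gives \<open>G2\<close>, where one degree moves from
    \<open>1 - x - y\<close> to \<open>x\<close>.\<close>
  define G1 where "G1 = (\<lambda>(x, y). (d * (a + c)) * (x ^ a * y ^ b * (1 - x - y :: real) powr s))"
  define G2 where "G2 = (\<lambda>(x, y). (- d * s) * (x ^ Suc a * y ^ b * (1 - x - y :: real) powr (s - 1)))"
  have "hom_span t (Suc m) G1" "hom_span t (Suc m) G2"
    unfolding G1_def G2_def
    using hom_span.monom[of a b "Suc m" t "d * (a + c)", folded s_def]
      hom_span.monom[of "Suc a" b "Suc m" t "- d * s", unfolded s(2)] monom
    by simp_all
  then have "hom_span t (Suc m) (\<lambda>z. G1 z + G2 z)" by (rule hom_span.add)
  moreover have "((\<lambda>u. F (u, y)) has_real_derivative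
      (G1 (x, y) + G2 (x, y) - c * F (x, y)) / x) (at x)" if "(x, y) \<in> open_simplex" for x y
  proof -
    have x: "0 < x" "0 < 1 - x - y" using that by auto
    have "((\<lambda>u. d * (u ^ a * y ^ b * (1 - u - y) powr s)) has_real_derivative
       d * (y ^ b * (real a * x ^ (a - 1) * (1 - x - y) powr s - x ^ a * (s * (1 - x - y) powr (s - 1))))) (at x)"
      using x by (auto intro!: derivative_eq_intros simp: algebra_simps)
    \<comment> \<open>For \<open>a = 0\<close> the truncated exponent \<open>a - 1\<close> is
      harmless, as its coefficient is \<open>0\<close>; hence the case split.\<close>
    also have "d * (y ^ b * (real a * x ^ (a - 1) * (1 - x - y) powr s - x ^ a * (s * (1 - x - y) powr (s - 1))))
      = (G1 (x, y) + G2 (x, y) - c * F (x, y)) / x"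
      using x by (cases a) (auto simp: G1_def G2_def F_def field_simps)
    finally show ?thesis by (simp add: F_def)
  qed
  moreover have "\<exists>I. has_moment p q F I \<and> has_moment p q (\<lambda>z. G1 z + G2 z) ((c - p - 1) * I)"
    if pq: "-1 < p" "-1 < q" for p q
  proof -
    define K where "K = Gamma (p + a + 1) * Gamma (q + b + 1) * Gamma (s + 1) / Gamma (p + a + q + b + s + 3)"
    have nonpos: "p + a + 1 \<notin> \<int>\<^sub>\<le>\<^sub>0" "s \<notin> \<int>\<^sub>\<le>\<^sub>0"
      using pq s by (auto simp: nonpos_Ints_def)
    have "Gamma (p + a + 1 + 1) = (p + a + 1) * Gamma (p + a + 1)" "Gamma (s + 1) = s * Gamma s"
      by (rule Gamma_plus1, rule nonpos)+
    \<comment> \<open>Homogeneity enters here: raising \<open>a\<close> and lowering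
      \<open>s\<close> by one leaves the denominator unchanged, so both moments are multiples of the
      same \<open>K\<close>.\<close>
    then have K: "Gamma (p + Suc a + 1) * Gamma (q + b + 1) * Gamma (s - 1 + 1) / Gamma (p + Suc a + q + b + (s - 1) + 3)
      = (p + a + 1) / s * K"
      using s unfolding K_def by (simp add: add_ac)
    have F: "has_moment p q F (d * K)" and G12: "has_moment p q G1 (d * (a + c) * K)"
      "has_moment p q G2 (- d * s * ((p + a + 1) / s * K))"
      unfolding F_def G1_def G2_def
      using has_moment_term[of p q s d a b, folded K_def]
        has_moment_term[of p q s "d * (a + c)" a b, folded K_def]
        has_moment_term[of p q "s - 1" "- d * s" "Suc a" b, unfolded K] pq s(1)
      by simp_all
    \<comment> \<open>The exponent \<open>a\<close> cancels. The factor is thus the same for all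
      terms, which is what allows the claim to pass to sums.\<close>
    have eq: "d * (a + c) * K + - d * s * ((p + a + 1) / s * K) = (c - p - 1) * (d * K)"
      using s by (simp add: field_simps)
    show ?thesis using F has_moment_add[OF G12, unfolded eq] by blast
  qed
  ultimately show ?case unfolding F_def s_def by blast
next
  case (add F1 F2)
  then obtain G1 G2 where
    G1: "hom_span t (Suc m) G1" "\<And>x y. (x, y) \<in> open_simplex \<Longrightarrow>
      ((\<lambda>u. F1 (u, y)) has_real_derivative (G1 (x, y) - c * F1 (x, y)) / x) (at x)"
      "\<And>p q. -1 < p \<Longrightarrow> -1 < q \<Longrightarrow> \<exists>I. has_moment p q F1 I \<and> has_moment p q G1 ((c - p - 1) * I)" and
    G2: "hom_span t (Suc m) G2" "\<And>x y. (x, y) \<in> open_simplex \<Longrightarrow>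
      ((\<lambda>u. F2 (u, y)) has_real_derivative (G2 (x, y) - c * F2 (x, y)) / x) (at x)"
      "\<And>p q. -1 < p \<Longrightarrow> -1 < q \<Longrightarrow> \<exists>I. has_moment p q F2 I \<and> has_moment p q G2 ((c - p - 1) * I)"
    by metis
  show ?case
  proof (intro exI[of _ "\<lambda>z. G1 z + G2 z"] conjI allI impI)
    show "hom_span t (Suc m) (\<lambda>z. G1 z + G2 z)" by (intro hom_span.add G1 G2)
    show "((\<lambda>u. F1 (u, y) + F2 (u, y)) has_real_derivative
       (G1 (x, y) + G2 (x, y) - c * (F1 (x, y) + F2 (x, y))) / x) (at x)"
      if "(x, y) \<in> open_simplex" for x y
      using DERIV_add[OF G1(2)[OF that] G2(2)[OF that]]
      by (simp add: add_divide_distrib diff_divide_distrib algebra_simps)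
    show "\<exists>I. has_moment p q (\<lambda>z. F1 z + F2 z) I \<and>
       has_moment p q (\<lambda>z. G1 z + G2 z) ((c - p - 1) * I)" if "-1 < p" "-1 < q" for p q
    proof -
      obtain I J where "has_moment p q F1 I" "has_moment p q G1 ((c - p - 1) * I)"
        "has_moment p q F2 J" "has_moment p q G2 ((c - p - 1) * J)"
        using G1(3) G2(3) \<open>-1 < p\<close> \<open>-1 < q\<close> by metis
      then have "has_moment p q (\<lambda>z. F1 z + F2 z) (I + J)"
        "has_moment p q (\<lambda>z. G1 z + G2 z) ((c - p - 1) * (I + J))"
        by (auto simp: distrib_left intro: has_moment_add)
      then show ?thesis by blast
    qed
  qed
qed

section \<open>Iterated partial derivatives\<close>

lemma partial_x_apply: "partial_x f (x, y) = deriv (\<lambda>t. f (t, y)) x"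
  and partial_y_apply: "partial_y f (x, y) = deriv (\<lambda>t. f (x, t)) y"
  by (simp_all add: partial_x_def partial_y_def)

lemma partial_x_cong:
  assumes "open S" "\<And>z. z \<in> S \<Longrightarrow> f z = g z" "z \<in> S"
  shows "partial_x f z = partial_x g z"
proof -
  obtain x y where z: "z = (x, y)" by (cases z)
  have "open ((\<lambda>u. (u, y)) -` S)"
    using assms(1) by (intro open_vimage) (auto intro!: continuous_intros)
  then have "eventually (\<lambda>u. f (u, y) = g (u, y)) (nhds x)"
    using assms z by (auto simp: eventually_nhds)
  then show ?thesis by (simp add: partial_x_apply z deriv_cong_ev)
qed

text \<open>By the product rule one derivative of \<open>x powr (a + n) * F\<close> lowers the power
  by one and replaces \<open>F\<close> by its image under
  \<open>x \<partial>\<^sub>x + a + n\<close>; \<open>hom_span_euler\<close> then supplies the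
  moment factor \<open>a + (n - 1) - p\<close>. Each derivative contributes one factor of the
  product. The function \<open>g\<close> holds the dependence on \<open>y\<close>, and
  \<open>f\<close> is prescribed only on the open simplex because its other values are
  uncontrolled.\<close>

lemma hom_span_partial_x:
  assumes "hom_span t m F" "real (m + n) - 1 < t"
  shows "\<exists>G. hom_span t (m + n) G \<and>
    (\<forall>f g. (\<forall>x y. (x, y) \<in> open_simplex \<longrightarrow> f (x, y) = x powr (a + real n) * g y * F (x, y)) \<longrightarrow>
      (\<forall>x y. (x, y) \<in> open_simplex \<longrightarrow> (partial_x ^^ n) f (x, y) = x powr a * g y * G (x, y))) \<and>
    (\<forall>p q I. -1 < p \<longrightarrow> -1 < q \<longrightarrow> has_moment p q F I \<longrightarrow>
      has_moment p q G ((\<Prod>i<n. a + real i - p) * I))"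
  using assms
proof (induction n arbitrary: m F)
  case 0
  then show ?case by (intro exI[of _ F]) auto
next
  case (Suc n)
  \<comment> \<open>The innermost of \<open>n + 1\<close> derivatives is treated first. It meets the
    power \<open>a + n + 1\<close>, which gives the factor with \<open>i = n\<close>.\<close>
  obtain F' where F': "hom_span t (Suc m) F'"
    "\<And>x y. (x, y) \<in> open_simplex \<Longrightarrow>
      ((\<lambda>u. F (u, y)) has_real_derivative (F' (x, y) - (a + n + 1) * F (x, y)) / x) (at x)"
    "\<And>p q. -1 < p \<Longrightarrow> -1 < q \<Longrightarrow> \<exists>I. has_moment p q F I \<and> has_moment p q F' (((a + n + 1) - p - 1) * I)"
    using hom_span_euler[OF Suc.prems(1), of "a + n + 1"] Suc.prems(2) by auto
  obtain G where G: "hom_span t (Suc m + n) G"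
    "\<And>f g x y. (\<And>x y. (x, y) \<in> open_simplex \<Longrightarrow> f (x, y) = x powr (a + real n) * g y * F' (x, y)) \<Longrightarrow>
      (x, y) \<in> open_simplex \<Longrightarrow> (partial_x ^^ n) f (x, y) = x powr a * g y * G (x, y)"
    "\<And>p q I. -1 < p \<Longrightarrow> -1 < q \<Longrightarrow> has_moment p q F' I \<Longrightarrow>
      has_moment p q G ((\<Prod>i<n. a + real i - p) * I)"
    using Suc.IH[OF F'(1)] Suc.prems(2) by (auto simp: add_ac)
  show ?case
  proof (intro exI[of _ G] conjI allI impI)
    show "hom_span t (m + Suc n) G" using G(1) by simp
    show "has_moment p q G ((\<Prod>i<Suc n. a + real i - p) * I)"
      if "-1 < p" "-1 < q" "has_moment p q F I" for p q I
    proof -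
      \<comment> \<open>\<open>hom_span_euler\<close> provides some moment of \<open>F\<close>;
        uniqueness identifies it with the given \<open>I\<close>.\<close>
      have "has_moment p q F' ((a + n - p) * I)"
        using F'(3)[OF that(1,2)] has_moment_unique[OF _ that(3)] by (force simp: add_diff_eq)
      from G(3)[OF that(1,2) this] show ?thesis by (simp add: mult_ac)
    qed
    fix f g x y
    assume f: "\<forall>x y. (x, y) \<in> open_simplex \<longrightarrow> f (x, y) = x powr (a + real (Suc n)) * g y * F (x, y)"
      and xy: "(x, y) \<in> open_simplex"
    have "partial_x f (x, y) = x powr (a + real n) * g y * F' (x, y)"
      if "(x, y) \<in> open_simplex" for x y
    proof -
      have "partial_x f (x, y) = partial_x (\<lambda>(x, y). x powr (a + real (Suc n)) * g y * F (x, y)) (x, y)"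
        using f that by (intro partial_x_cong[OF open_open_simplex]) auto
      also have "\<dots> = deriv (\<lambda>u. u powr (a + real (Suc n)) * g y * F (u, y)) x"
        by (simp add: partial_x_apply)
      also have "\<dots> = x powr (a + real n) * g y * F' (x, y)"
      proof (rule DERIV_imp_deriv)
        have x: "x > 0" using that by simp
        have "((\<lambda>u. u powr (a + real (Suc n)) * g y * F (u, y)) has_real_derivative
            (a + real (Suc n)) * x powr (a + real (Suc n) - 1) * g y * F (x, y) +
            (F' (x, y) - (a + n + 1) * F (x, y)) / x * (x powr (a + real (Suc n)) * g y)) (at x)"
          by (intro DERIV_mult DERIV_cmult_right has_real_derivative_powr F'(2) that x)
        also have "(a + real (Suc n)) * x powr (a + real (Suc n) - 1) * g y * F (x, y) +
            (F' (x, y) - (a + n + 1) * F (x, y)) / x * (x powr (a + real (Suc n)) * g y)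
          = x powr (a + real n) * g y * F' (x, y)"
          using x by (simp add: powr_add field_simps)
        finally show "((\<lambda>u. u powr (a + real (Suc n)) * g y * F (u, y)) has_real_derivative
            x powr (a + real n) * g y * F' (x, y)) (at x)" .
      qed
      finally show ?thesis .
    qed
    from G(2)[of "partial_x f" g, OF this xy]
    show "(partial_x ^^ Suc n) f (x, y) = x powr a * g y * G (x, y)"
      by (simp add: funpow_Suc_right del: funpow.simps)
  qed
qed

text \<open>Holds for arbitrary \<open>f\<close>, since at each stage both sides are
  \<open>deriv\<close> of the same function.\<close>

lemma partial_y_iterate_conv_partial_x:
  "(partial_y ^^ n) f (x, y) = (partial_x ^^ n) (\<lambda>(x, y). f (y, x)) (y, x)"
proof (induction n arbitrary: x y)
  case (Suc n)
  have "(\<lambda>t. (partial_y ^^ n) f (x, t)) = (\<lambda>t. (partial_x ^^ n) (\<lambda>(x, y). f (y, x)) (t, x))"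
    by (rule ext) (rule Suc.IH)
  then show ?case by (simp add: partial_x_apply partial_y_apply)
qed simp

lemma hom_span_partial_y:
  assumes "hom_span t m F" "real (m + n) - 1 < t"
  shows "\<exists>G. hom_span t (m + n) G \<and>
    (\<forall>f g. (\<forall>x y. (x, y) \<in> open_simplex \<longrightarrow> f (x, y) = g x * y powr (b + real n) * F (x, y)) \<longrightarrow>
      (\<forall>x y. (x, y) \<in> open_simplex \<longrightarrow> (partial_y ^^ n) f (x, y) = g x * y powr b * G (x, y))) \<and>
    (\<forall>p q I. -1 < p \<longrightarrow> -1 < q \<longrightarrow> has_moment p q F I \<longrightarrow>
      has_moment p q G ((\<Prod>i<n. b + real i - q) * I))"
proof -
  obtain G where G: "hom_span t (m + n) G"
    "\<And>f g x y. (\<And>x y. (x, y) \<in> open_simplex \<Longrightarrow> f (x, y) = x powr (b + real n) * g y * F (y, x)) \<Longrightarrow>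
      (x, y) \<in> open_simplex \<Longrightarrow> (partial_x ^^ n) f (x, y) = x powr b * g y * G (x, y)"
    "\<And>p q I. -1 < p \<Longrightarrow> -1 < q \<Longrightarrow> has_moment p q (\<lambda>(x, y). F (y, x)) I \<Longrightarrow>
      has_moment p q G ((\<Prod>i<n. b + real i - p) * I)"
    using hom_span_partial_x[OF hom_span_swap[OF assms(1)] assms(2), of b] by auto
  show ?thesis
  proof (intro exI[of _ "\<lambda>(x, y). G (y, x)"] conjI allI impI)
    show "hom_span t (m + n) (\<lambda>(x, y). G (y, x))" by (rule hom_span_swap[OF G(1)])
    show "has_moment p q (\<lambda>(x, y). G (y, x)) ((\<Prod>i<n. b + real i - q) * I)"
      if "-1 < p" "-1 < q" "has_moment p q F I" for p q I
      using that by (intro has_moment_swap G(3))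
    fix f g x y
    assume "\<forall>x y. (x, y) \<in> open_simplex \<longrightarrow> f (x, y) = g x * y powr (b + real n) * F (x, y)"
      and "(x, y) \<in> open_simplex"
    then show "(partial_y ^^ n) f (x, y) = g x * y powr b * (case (x, y) of (x, y) \<Rightarrow> G (y, x))"
      using G(2)[of "\<lambda>(x, y). f (y, x)" g y x]
      by (simp add: partial_y_iterate_conv_partial_x add.commute mult_ac)
  qed
qed

section \<open>The Rodrigues operators and their composition\<close>

text \<open>Multiplying by \<open>(1 - x - y) powr c\<close> turns the operator into a map from
  \<open>F\<close> to \<open>G\<close>: the weight and the extra powers become
  \<open>x powr (a + (n - k)) * y powr (b + k)\<close>, and the derivatives lower these to the
  powers \<open>a\<close> and \<open>b\<close> that the division by the weight removes.\<close>

lemma hom_span_rodrigues_op: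
  assumes F: "hom_span t m F" and m: "real (m + n) - 1 < t" and k: "k \<le> n"
    and f: "\<And>x y. (x, y) \<in> open_simplex \<Longrightarrow> (1 - x - y) powr c * f (x, y) = F (x, y)"
  shows "\<exists>G. hom_span t (m + n) G \<and>
    (\<forall>x y. (x, y) \<in> open_simplex \<longrightarrow>
      (1 - x - y) powr c * rodrigues_op a b c n k f (x, y) = G (x, y)) \<and>
    (\<forall>p q I. -1 < p \<longrightarrow> -1 < q \<longrightarrow> has_moment p q F I \<longrightarrow>
      has_moment p q G ((\<Prod>i<n - k. a + real i - p) * (\<Prod>i<k. b + real i - q) * I))"
proof -
  have m': "real (m + k) - 1 < t" "real (m + k + (n - k)) - 1 < t" using m k by auto
  obtain H where H: "hom_span t (m + k) H"
    "\<And>f g x y. (\<And>x y. (x, y) \<in> open_simplex \<Longrightarrow> f (x, y) = g x * y powr (b + real k) * F (x, y)) \<Longrightarrow>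
      (x, y) \<in> open_simplex \<Longrightarrow> (partial_y ^^ k) f (x, y) = g x * y powr b * H (x, y)"
    "\<And>p q I. -1 < p \<Longrightarrow> -1 < q \<Longrightarrow> has_moment p q F I \<Longrightarrow>
      has_moment p q H ((\<Prod>i<k. b + real i - q) * I)"
    using hom_span_partial_y[OF F m'(1), of b] by auto
  obtain G where G: "hom_span t (m + k + (n - k)) G"
    "\<And>f g x y. (\<And>x y. (x, y) \<in> open_simplex \<Longrightarrow> f (x, y) = x powr (a + real (n - k)) * g y * H (x, y)) \<Longrightarrow>
      (x, y) \<in> open_simplex \<Longrightarrow> (partial_x ^^ (n - k)) f (x, y) = x powr a * g y * G (x, y)"
    "\<And>p q I. -1 < p \<Longrightarrow> -1 < q \<Longrightarrow> has_moment p q H I \<Longrightarrow>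
      has_moment p q G ((\<Prod>i<n - k. a + real i - p) * I)"
    using hom_span_partial_x[OF H(1) m'(2), of a] by auto
  define h where "h = (\<lambda>(u, v). weight a b c (u, v) * u ^ (n - k) * v ^ k * f (u, v))"
  have h: "h (x, y) = x powr (a + real (n - k)) * y powr (b + real k) * F (x, y)"
    if "(x, y) \<in> open_simplex" for x y
    using that f[OF that, symmetric]
    by (simp add: h_def weight_def powr_add powr_realpow mult_ac del: of_nat_diff)
  \<comment> \<open>During the derivatives in \<open>y\<close> the power of \<open>x\<close> is a
    spectator passed as \<open>g\<close>; during those in \<open>x\<close> the power of
    \<open>y\<close> is.\<close>
  have "(partial_y ^^ k) h (x, y) = x powr (a + real (n - k)) * y powr b * H (x, y)"
    if "(x, y) \<in> open_simplex" for x y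
    using H(2)[of h "\<lambda>x. x powr (a + real (n - k))", OF h that] .
  then have "(partial_x ^^ (n - k)) ((partial_y ^^ k) h) (x, y) = x powr a * y powr b * G (x, y)"
    if "(x, y) \<in> open_simplex" for x y
    using G(2)[of "(partial_y ^^ k) h" "\<lambda>y. y powr b"] that by blast
  then have "(1 - x - y) powr c * rodrigues_op a b c n k f (x, y) = G (x, y)"
    if "(x, y) \<in> open_simplex" for x y
    using that unfolding rodrigues_op_def h_def[symmetric] by (simp add: weight_def field_simps)
  moreover have "has_moment p q G ((\<Prod>i<n - k. a + real i - p) * (\<Prod>i<k. b + real i - q) * I)"
    if "-1 < p" "-1 < q" "has_moment p q F I" for p q I
    using G(3)[OF that(1,2) H(3)[OF that]] by (simp add: mult_ac)
  ultimately show ?thesis using G(1) k by (intro exI[of _ G]) auto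
qed

text \<open>Induction on the number of operators with the initial exponent \<open>N\<close> fixed,
  so that the starting function stays the same. As \<open>N\<close> bounds the total order, no
  exponent of \<open>1 - x - y\<close> falls below \<open>c > -1\<close>. The moment factors are
  scalars depending on \<open>p\<close> and \<open>q\<close>, so they simply multiply.\<close>

lemma hom_span_fold_rodrigues_op:
  assumes "-1 < c" "\<And>i. i \<in> {1..r} \<Longrightarrow> ks i \<le> ns i" "(\<Sum>i=1..r. ns i) \<le> N"
  shows "\<exists>G. hom_span (c + real N) (\<Sum>i=1..r. ns i) G \<and>
    (\<forall>x y. (x, y) \<in> open_simplex \<longrightarrow> (1 - x - y) powr c *
      fold (\<lambda>j. rodrigues_op (\<alpha> j) (\<beta> j) c (ns j) (ks j)) [1..<Suc r]
        (\<lambda>(x, y). (1 - x - y) ^ N) (x, y) = G (x, y)) \<and>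
    (\<forall>p q. -1 < p \<longrightarrow> -1 < q \<longrightarrow> (\<exists>I. has_moment p q G
      ((\<Prod>j=1..r. (\<Prod>i<ns j - ks j. \<alpha> j + real i - p) * (\<Prod>i<ks j. \<beta> j + real i - q)) * I)))"
  using assms(2,3)
proof (induction r)
  case 0
  \<comment> \<open>This is \<open>(1 - x - y) powr (c + N)\<close>, written in the shape of the
    rule \<open>hom_span.monom\<close>.\<close>
  define G where "G = (\<lambda>(x, y). (1 :: real) * (x ^ 0 * y ^ 0 * (1 - x - y :: real) powr (c + real N - real 0 - real 0)))"
  have G: "hom_span (c + real N) 0 G" unfolding G_def by (rule hom_span.monom) simp
  have "\<exists>I. has_moment p q G I" if "-1 < p" "-1 < q" for p q
    using hom_span_has_moment[OF G that] assms(1) by simp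
  moreover have "(1 - x - y) powr c * (1 - x - y) ^ N = G (x, y)" if "(x, y) \<in> open_simplex" for x y
    using that by (simp add: G_def powr_add powr_realpow)
  ultimately show ?case using G by (intro exI[of _ G]) auto
next
  case (Suc r)
  let ?f = "fold (\<lambda>j. rodrigues_op (\<alpha> j) (\<beta> j) c (ns j) (ks j)) [1..<Suc r]
        (\<lambda>(x, y). (1 - x - y) ^ N)"
  obtain F where F: "hom_span (c + real N) (\<Sum>i=1..r. ns i) F"
    "\<And>x y. (x, y) \<in> open_simplex \<Longrightarrow> (1 - x - y) powr c * ?f (x, y) = F (x, y)"
    "\<And>p q. -1 < p \<Longrightarrow> -1 < q \<Longrightarrow> \<exists>I. has_moment p q F
      ((\<Prod>j=1..r. (\<Prod>i<ns j - ks j. \<alpha> j + real i - p) * (\<Prod>i<ks j. \<beta> j + real i - q)) * I)"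
    using Suc.IH Suc.prems by auto
  have "real ((\<Sum>i=1..r. ns i) + ns (Suc r)) \<le> real N"
    using Suc.prems(2) by (intro of_nat_mono) simp
  then have bound: "real ((\<Sum>i=1..r. ns i) + ns (Suc r)) - 1 < c + real N"
    using assms(1) by linarith
  obtain G where G: "hom_span (c + real N) ((\<Sum>i=1..r. ns i) + ns (Suc r)) G"
    "\<And>x y. (x, y) \<in> open_simplex \<Longrightarrow> (1 - x - y) powr c *
        rodrigues_op (\<alpha> (Suc r)) (\<beta> (Suc r)) c (ns (Suc r)) (ks (Suc r)) ?f (x, y) = G (x, y)"
    "\<And>p q I. -1 < p \<Longrightarrow> -1 < q \<Longrightarrow> has_moment p q F I \<Longrightarrow>
      has_moment p q G ((\<Prod>i<ns (Suc r) - ks (Suc r). \<alpha> (Suc r) + real i - p) *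
        (\<Prod>i<ks (Suc r). \<beta> (Suc r) + real i - q) * I)"
    using hom_span_rodrigues_op[OF F(1) bound Suc.prems(1)[of "Suc r"] F(2),
        of "\<alpha> (Suc r)" "\<beta> (Suc r)"] by auto
  show ?case
  proof (intro exI[of _ G] conjI allI impI)
    show "hom_span (c + real N) (\<Sum>i=1..Suc r. ns i) G" using G(1) by simp
    show "(1 - x - y) powr c * fold (\<lambda>j. rodrigues_op (\<alpha> j) (\<beta> j) c (ns j) (ks j)) [1..<Suc (Suc r)]
        (\<lambda>(x, y). (1 - x - y) ^ N) (x, y) = G (x, y)" if "(x, y) \<in> open_simplex" for x y
      using G(2)[OF that] by simp
    show "\<exists>I. has_moment p q G ((\<Prod>j=1..Suc r. (\<Prod>i<ns j - ks j. \<alpha> j + real i - p) *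
        (\<Prod>i<ks j. \<beta> j + real i - q)) * I)" if pq: "-1 < p" "-1 < q" for p q
    proof -
      let ?P = "\<lambda>j. (\<Prod>i<ns j - ks j. \<alpha> j + real i - p) * (\<Prod>i<ks j. \<beta> j + real i - q)"
      obtain I where "has_moment p q F ((\<Prod>j=1..r. ?P j) * I)" using F(3)[OF pq] by blast
      from G(3)[OF pq this] have "has_moment p q G (?P (Suc r) * ((\<Prod>j=1..r. ?P j) * I))" .
      moreover have "?P (Suc r) * ((\<Prod>j=1..r. ?P j) * I) = (\<Prod>j=1..Suc r. ?P j) * I"
        by (simp add: mult_ac)
      ultimately show ?thesis by metis
    qed
  qed
qed

section \<open>From the open simplex to the closed triangle, and orthogonality\<close>

lemma negligible_triangle_diff_open_simplex: "negligible (triangle - open_simplex)"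
proof (rule negligible_subset)
  show "negligible ({z. (1, 0) \<bullet> z = 0} \<union> {z. (0, 1) \<bullet> z = 0} \<union> {z. (1, 1) \<bullet> z = (1::real)}
    :: (real \<times> real) set)"
    by (intro negligible_Un negligible_hyperplane) (auto simp: zero_prod_def)
  show "triangle - open_simplex \<subseteq>
    {z. (1, 0) \<bullet> z = 0} \<union> {z. (0, 1) \<bullet> z = 0} \<union> {z. (1, 1) \<bullet> z = 1}"
    by (auto simp: triangle_def)
qed

text \<open>The values of \<open>f\<close> on the sides are unknown, but the sides form a null set
  and \<open>lebesgue\<close> is complete, so \<open>f\<close> may be replaced by the function
  \<open>g\<close> that vanishes there.\<close>

lemma has_moment_imp_set_integral:
  assumes "has_moment p q F I"
    and "\<And>x y. (x, y) \<in> open_simplex \<Longrightarrow> f (x, y) = x powr p * y powr q * F (x, y)"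
  shows "f absolutely_integrable_on triangle" "(LINT z:triangle|lebesgue. f z) = I"
proof -
  define g where "g = (\<lambda>(x, y). indicator open_simplex (x, y) * (x powr p * y powr q * F (x, y)))"
  have "has_bochner_integral lborel g I"
    using assms(1) by (simp add: has_moment_def g_def)
  then have g: "integrable lebesgue g" "integral\<^sup>L lebesgue g = I"
    by (auto simp: has_bochner_integral_iff integrable_completion integral_completion)
  have ind: "(\<lambda>z. indicator triangle z *\<^sub>R g z) = g"
    by (auto simp: g_def triangle_def indicator_def fun_eq_iff)
  have g': "g absolutely_integrable_on triangle"
    using g(1) unfolding set_integrable_def ind .
  have eq: "f z = g z" if "z \<in> triangle - (triangle - open_simplex)" for z
    using that assms(2)[of "fst z" "snd z"] by (cases z) (auto simp: g_def)
  show f: "f absolutely_integrable_on triangle"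
    by (rule absolutely_integrable_spike[OF g' negligible_triangle_diff_open_simplex eq])
  have "(LINT z:triangle|lebesgue. f z) = (LINT z:triangle|lebesgue. g z)"
    using integral_spike[OF negligible_triangle_diff_open_simplex eq]
    by (simp add: set_lebesgue_integral_eq_integral f g')
  also have "\<dots> = I" using g(2) unfolding set_lebesgue_integral_def ind .
  finally show "(LINT z:triangle|lebesgue. f z) = I" .
qed

theorem proposition3p8:
  fixes r :: nat and \<alpha> \<beta> :: "nat \<Rightarrow> real" and \<gamma> :: real
    and ns ks :: "nat \<Rightarrow> nat" and j n k :: nat
  assumes "2 \<le> r"
    and "\<And>i. i \<in> {1..r} \<Longrightarrow> -1 < \<alpha> i"
    and "\<And>i. i \<in> {1..r} \<Longrightarrow> -1 < \<beta> i"
    and "-1 < \<gamma>"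
    and "\<And>i l. i \<in> {1..r} \<Longrightarrow> l \<in> {1..r} \<Longrightarrow> i \<noteq> l \<Longrightarrow> (\<alpha> i, \<beta> i) \<noteq> (\<alpha> l, \<beta> l)"
    and "\<And>i. i \<in> {1..r} \<Longrightarrow> ks i \<le> ns i"
    and "j \<in> {1..r}"
    and "k \<le> n"
    and "n - k < ns j - ks j \<or> k < ks j"
  shows "(\<lambda>(x, y). mult_orth_poly r \<alpha> \<beta> \<gamma> ns ks (x, y) * x ^ (n - k) * y ^ k
            * weight (\<alpha> j) (\<beta> j) \<gamma> (x, y)) absolutely_integrable_on triangle
       \<and> (LINT (x, y):triangle|lebesgue. mult_orth_poly r \<alpha> \<beta> \<gamma> ns ks (x, y) * x ^ (n - k) * y ^ k
            * weight (\<alpha> j) (\<beta> j) \<gamma> (x, y)) = 0"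
proof -
  \<comment> \<open>The total exponents of \<open>x\<close> and \<open>y\<close> in the test
    monomial times the weight; the factor \<open>(1 - x - y) powr \<gamma>\<close> goes into
    \<open>G\<close>.\<close>
  define p where "p = \<alpha> j + real (n - k)"
  define q where "q = \<beta> j + real k"
  have pq: "-1 < p" "-1 < q"
    using assms(2,3)[OF assms(7)] by (simp_all add: p_def q_def del: of_nat_diff)
  obtain G I where
    G: "\<And>x y. (x, y) \<in> open_simplex \<Longrightarrow>
      (1 - x - y) powr \<gamma> * mult_orth_poly r \<alpha> \<beta> \<gamma> ns ks (x, y) = G (x, y)"
    and I: "has_moment p q G ((\<Prod>j=1..r. (\<Prod>i<ns j - ks j. \<alpha> j + real i - p) *
      (\<Prod>i<ks j. \<beta> j + real i - q)) * I)"
    using hom_span_fold_rodrigues_op[where r = r and ns = ns and ks = ks and \<alpha> = \<alpha> and \<beta> = \<beta>,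
        OF assms(4) assms(6) order_refl] pq
    unfolding mult_orth_poly_def by blast
  \<comment> \<open>With these exponents the factors are \<open>i - (n - k)\<close> and
    \<open>i - k\<close>. One of them vanishes, at \<open>i = n - k\<close> or at
    \<open>i = k\<close>, exactly because that index lies in the range of its product.\<close>
  have "(\<Prod>i<ns j - ks j. \<alpha> j + real i - p) * (\<Prod>i<ks j. \<beta> j + real i - q) = 0"
    using assms(9) by (auto simp: p_def q_def prod_zero_iff simp del: of_nat_diff)
  then have "(\<Prod>j=1..r. (\<Prod>i<ns j - ks j. \<alpha> j + real i - p) * (\<Prod>i<ks j. \<beta> j + real i - q)) = 0"
    using assms(7) by (intro prod_zero) auto
  from I[unfolded this] have zero: "has_moment p q G 0" by simp
  have "(\<lambda>(x, y). mult_orth_poly r \<alpha> \<beta> \<gamma> ns ks (x, y) * x ^ (n - k) * y ^ k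
      * weight (\<alpha> j) (\<beta> j) \<gamma> (x, y)) (x, y) = x powr p * y powr q * G (x, y)"
    if "(x, y) \<in> open_simplex" for x y
    unfolding G[OF that, symmetric] using that
    by (simp add: p_def q_def weight_def powr_add powr_realpow mult_ac del: of_nat_diff)
  from has_moment_imp_set_integral[OF zero this] show ?thesis by (rule conjI)
qed

end
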